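(* Let $d\ge 2$ be an integer. Let $V:(0,1)\to\mathbb{R}^{+}$ be a decreasing function such that $V(\epsilon)\to+\infty$ as $\epsilon\to 0^{+}$. Assume that there exists a decreasing sequence $(e_j)_{j\ge 1}$ in $(0,1)$ with $e_j\to 0$ as $j\to+\infty$ such that $$\sum_{j\ge 1}\frac{e_j^{-(d-1)}}{V(e_j)}<+\infty .$$ Then there exists (by a deterministic construction) a dense forest in $\mathbb{R}^{d}$ with visibility function $W:(0,1)\to\mathbb{R}^{+}$ given by $W(\epsilon)=V(e_i)$, where $i=i(\epsilon)\ge 1$ is the unique index such that $e_i\le\epsilon<e_{i-1}$ (with the convention $e_0=1$).
   Context: $\mathbb{R}^{+}$ denotes the positive reals; "decreasing" means non-increasing. $B_2(0,T)$ is the Euclidean ball of radius $T$ centred at the origin of $\mathbb{R}^d$, and $\mathrm{dist}$ is the Euclidean distance. A subset $Y\subseteq\mathbb{R}^{d}$ has finite density if $\#(B_2(0,T)\cap Y)=O(T^{d})$, i.e. there is $C>0$ with $\#(B_2(0,T)\cap Y)\le C\,T^d$ for every $T>0$. A set $\mathfrak{F}\subseteq\mathbb{R}^{d}$ is a dense forest with visibility function $W$ if $\mathfrak{F}$ has finite density and $W:(0,1)\to\mathbb{R}^{+}$ is a decreasing function tending to $+\infty$ as $\epsilon\to0^{+}$ such that for any $\epsilon\in(0,1)$ and any line segment $L\subseteq\mathbb{R}^{d}$ of length $W(\epsilon)$, there is a point $x\in\mathfrak{F}$ with $\mathrm{dist}(x,L)\le\epsilon$. "Deterministic construction" means that the set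 is specified without any random choice. *)

theory Defs
  imports "HOL-Analysis.Analysis"
begin

definition finite_density :: "(real ^ 'n::finite) set \<Rightarrow> bool" where
  "finite_density Y \<longleftrightarrow>
    (\<exists>C>0. \<forall>T>0. finite (cball 0 T \<inter> Y) \<and> real (card (cball 0 T \<inter> Y)) \<le> C * T ^ CARD('n))"

text \<open>Functions on the interval from 0 to 1 are represented by total functions on the reals,
  whose values outside \<open>{0<..<1}\<close> are irrelevant.  As everywhere in the library,
  \<open>antimono_on\<close> is the non-strict notion.\<close>

definition blowup_function :: "(real \<Rightarrow> real) \<Rightarrow> bool" where
  "blowup_function W \<longleftrightarrow>
    (\<forall>\<epsilon>\<in>{0<..<1}. W \<epsilon> > 0) \<and> antimono_on {0<..<1} W \<and> filterlim W at_top (at_right 0)"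

definition dense_forest :: "(real ^ 'n::finite) set \<Rightarrow> (real \<Rightarrow> real) \<Rightarrow> bool" where
  "dense_forest F W \<longleftrightarrow>
    finite_density F \<and> blowup_function W \<and>
    (\<forall>\<epsilon>\<in>{0<..<1}. \<forall>a b. dist a b = W \<epsilon> \<longrightarrow> (\<exists>x\<in>F. infdist x (closed_segment a b) \<le> \<epsilon>))"

text \<open>A sequence indexed from 1 is a function on \<open>nat\<close> whose value at 0 is ignored; the
  update \<open>e(0 := 1)\<close> is the convention that the term of index 0 is 1.\<close>

definition scale_index :: "(nat \<Rightarrow> real) \<Rightarrow> real \<Rightarrow> nat" where
  "scale_index e \<epsilon> = (THE i. i \<ge> 1 \<and> e i \<le> \<epsilon> \<and> \<epsilon> < (e(0 := 1)) (i - 1))"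

text \<open>The definite description is well-defined in the situation of interest.\<close>

lemma scale_index_ex1:
  fixes e :: "nat \<Rightarrow> real"
  assumes anti: "antimono_on {1..} e" and lim: "e \<longlonglongrightarrow> 0" and \<epsilon>: "\<epsilon> \<in> {0<..<1}"
  shows "\<exists>!i. i \<ge> 1 \<and> e i \<le> \<epsilon> \<and> \<epsilon> < (e(0 := 1)) (i - 1)"
proof -
  define P where "P i \<longleftrightarrow> i \<ge> 1 \<and> e i \<le> \<epsilon>" for i
  have "eventually (\<lambda>i. e i < \<epsilon>) sequentially"
    using order_tendstoD(2)[OF lim] \<epsilon> by simp
  then obtain N where "\<And>i. i \<ge> N \<Longrightarrow> e i < \<epsilon>"
    unfolding eventually_sequentially by blast
  then have "P (max 1 N)"
    unfolding P_def by (simp add: less_imp_le)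
  define m where "m = (LEAST i. P i)"
  have P: "m \<ge> 1" "e m \<le> \<epsilon>"
    using LeastI[of P, OF \<open>P (max 1 N)\<close>] unfolding m_def[symmetric] by (auto simp: P_def)
  have below: "\<not> P i" if "i < m" for i
    using not_less_Least that unfolding m_def by blast
  show ?thesis
  proof (rule ex1I[of _ m])
    have "\<epsilon> < (e(0 := 1)) (m - 1)"
      using below[of "m - 1"] P \<epsilon> unfolding P_def by auto
    then show "m \<ge> 1 \<and> e m \<le> \<epsilon> \<and> \<epsilon> < (e(0 := 1)) (m - 1)"
      using P unfolding P_def by auto
  next
    fix i assume i: "i \<ge> 1 \<and> e i \<le> \<epsilon> \<and> \<epsilon> < (e(0 := 1)) (i - 1)"
    then have "m \<le> i"
      using below[of i] unfolding P_def by force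
    moreover have False if "m < i"
    proof -
      have "e (i - 1) \<le> e m"
        using monotone_onD[OF anti, of m "i - 1"] that P by auto
      then show False
        using i P that by auto
    qed
    ultimately show "i = m"
      by (cases "m < i") auto
  qed
qed

end

theory Submission imports Defs begin

text \<open>
  For a scale \<open>e\<close> with visibility \<open>V\<close>, take the hyperplanes orthogonal to the coordinate axes with
  offsets in \<open>(\<int> + 1/2) h\<close>, \<open>h = V / d\<close>, and put on each of them a grid of mesh \<open>e / d\<close>.  A segment
  of length \<open>V\<close> has extent at least \<open>V / d\<close> in some coordinate direction, so it crosses one of these
  hyperplanes and passes within \<open>e\<close> of a grid point.  Since the offsets avoid 0, a ball of radius
  \<open>T < h / 2\<close> contains no point, and for larger \<open>T\<close> the number of points is at most a constant times
  \<open>T ^ d / (e ^ (d - 1) * V)\<close>.  These bounds are summable over the scales \<open>e\<^sub>j\<close>,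
  hence the union over all scales has finite density.
\<close>

definition slab_grid :: "real \<Rightarrow> real \<Rightarrow> (real ^ 'n::finite) set" where
  "slab_grid h s = {x. \<exists>i. (\<exists>k::int. x $ i = (of_int k + 1/2) * h) \<and>
                           (\<forall>l. l \<noteq> i \<longrightarrow> (\<exists>m::int. x $ l = of_int m * s))}"

section \<open>Counting the points of one slab grid in a ball\<close>

text \<open>The points correspond to integers in an interval of length \<open>2 * T / h\<close>,
  whatever the shift. The free shift \<open>c\<close> lets one count serve both the hyperplane
  offsets (\<open>c = 1/2\<close>) and the grid coordinates (\<open>c = 0\<close>).\<close>

lemma card_progression_le:
  fixes c h T :: real
  assumes "h > 0" "T \<ge> 0"
  defines "P \<equiv> {x. \<bar>x\<bar> \<le> T \<and> (\<exists>k::int. x = (of_int k + c) * h)}"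
  shows "finite P" "real (card P) \<le> 2 * T / h + 1"
proof -
  let ?I = "{\<lceil>- T / h - c\<rceil>..\<lfloor>T / h - c\<rfloor>}"
  have "P \<subseteq> (\<lambda>k. (of_int k + c) * h) ` ?I"
  proof
    fix x assume "x \<in> P"
    then obtain k :: int where k: "x = (of_int k + c) * h" "\<bar>x\<bar> \<le> T"
      unfolding P_def by auto
    then have "- T / h \<le> of_int k + c" "of_int k + c \<le> T / h"
      using \<open>h > 0\<close> by (auto simp: field_simps abs_le_iff)
    then have "k \<in> ?I"
      by (auto simp: ceiling_le_iff le_floor_iff)
    then show "x \<in> (\<lambda>k. (of_int k + c) * h) ` ?I"
      using k by blast
  qed
  then show "finite P"
    using finite_subset by blast
  have "card P \<le> card ?I"
    using \<open>P \<subseteq> _\<close> by (rule surj_card_le[rotated]) simp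
  moreover have "real (card ?I) \<le> 2 * T / h + 1"
  proof (cases "\<lceil>- T / h - c\<rceil> \<le> \<lfloor>T / h - c\<rfloor>")
    case True
    then have "real (card ?I) = of_int (\<lfloor>T / h - c\<rfloor> - \<lceil>- T / h - c\<rceil> + 1)"
      by simp
    also have "\<dots> \<le> (T / h - c) - (- T / h - c) + 1"
      using of_int_floor_le[of "T / h - c"] le_of_int_ceiling[of "- T / h - c"] by linarith
    finally show ?thesis
      by simp
  next
    case False
    then show ?thesis using assms by simp
  qed
  ultimately show "real (card P) \<le> 2 * T / h + 1"
    by linarith
qed

text \<open>Over the whole index type extensionality is vacuous, so \<open>vec_nth\<close> is a
  bijection from the box onto \<open>PiE UNIV A\<close>.\<close>

lemma card_vec_box:
  fixes A :: "'n::finite \<Rightarrow> 'a set"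
  assumes "\<And>i. finite (A i)"
  shows "finite {x :: 'a ^ 'n. \<forall>i. x $ i \<in> A i}" "card {x :: 'a ^ 'n. \<forall>i. x $ i \<in> A i} = (\<Prod>i\<in>UNIV. card (A i))"
proof -
  have "bij_betw vec_nth {x :: 'a ^ 'n. \<forall>i. x $ i \<in> A i} (PiE UNIV A)"
    by (rule bij_betwI[where g = vec_lambda]) (auto simp: PiE_def extensional_def vec_lambda_beta)
  with assms show "finite {x :: 'a ^ 'n. \<forall>i. x $ i \<in> A i}"
    "card {x :: 'a ^ 'n. \<forall>i. x $ i \<in> A i} = (\<Prod>i\<in>UNIV. card (A i))"
    by (auto simp: bij_betw_finite bij_betw_same_card card_PiE finite_PiE)
qed

lemma slab_grid_cball_empty:
  assumes "T < h / 2"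
  shows "cball 0 T \<inter> (slab_grid h s :: (real ^ 'n::finite) set) = {}"
proof (rule ccontr)
  assume "cball 0 T \<inter> (slab_grid h s :: (real ^ 'n) set) \<noteq> {}"
  then obtain x :: "real ^ 'n" and i and k :: int where x: "norm x \<le> T" "x $ i = (of_int k + 1/2) * h"
    unfolding slab_grid_def by auto
  \<comment> \<open>The sign of \<open>h\<close> comes from here: \<open>0 \<le> T\<close> and
    \<open>T < h / 2\<close> make \<open>h\<close> positive.\<close>
  then have "0 \<le> T"
    using norm_ge_zero order_trans by blast
  have "\<bar>of_int k + 1/2 :: real\<bar> \<ge> 1/2"
    by (cases "k \<ge> 0") (auto simp: abs_if)
  then have "h / 2 \<le> \<bar>x $ i\<bar>"
    using assms \<open>0 \<le> T\<close> x(2) mult_right_mono[of "1/2" "\<bar>of_int k + 1/2\<bar>" h] by (simp add: abs_mult)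
  then show False
    using component_le_norm_cart[of x i] x(1) assms by linarith
qed

text \<open>The ball lies in the cube of half-side \<open>T\<close>, so the points with
  distinguished direction \<open>i\<close> lie in a product of one progression of step
  \<open>h\<close> and \<open>CARD('n) - 1\<close> progressions of step \<open>s\<close>. The
  leading factor counts the directions.\<close>

lemma card_slab_grid_le:
  fixes h s T :: real
  assumes "h > 0" "s > 0" "T \<ge> h / 2"
  defines "G \<equiv> cball 0 T \<inter> (slab_grid h s :: (real ^ 'n::finite) set)"
  shows "finite G" "real (card G) \<le> CARD('n) * (4 * T / h) * (2 * T / s + 1) ^ (CARD('n) - 1)"
proof -
  define P where "P c r = {x. \<bar>x\<bar> \<le> T \<and> (\<exists>k::int. x = (of_int k + c) * r)}" for c r :: real
  define B where "B i = {x :: real ^ 'n. \<forall>l. x $ l \<in> (if l = i then P (1/2) h else P 0 s)}" for i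
  have T: "T \<ge> 0" using assms by simp
  note P = card_progression_le[OF \<open>h > 0\<close> T, of "1/2", folded P_def]
           card_progression_le[OF \<open>s > 0\<close> T, of 0, folded P_def]
  have sub: "G \<subseteq> (\<Union>i\<in>UNIV. B i)"
  proof
    fix x assume "x \<in> G"
    then obtain i where x: "norm x \<le> T" "\<exists>k::int. x $ i = (of_int k + 1/2) * h"
      "\<And>l. l \<noteq> i \<Longrightarrow> \<exists>m::int. x $ l = of_int m * s"
      unfolding G_def slab_grid_def by auto
    have "\<bar>x $ l\<bar> \<le> T" for l
      using component_le_norm_cart[of x l] x(1) by linarith
    then have "x \<in> B i"
      using x unfolding B_def P_def by auto
    then show "x \<in> (\<Union>i\<in>UNIV. B i)" by blast
  qed
  have finB: "finite (B i)" for i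
    unfolding B_def by (rule card_vec_box) (use P in auto)
  then show "finite G"
    by (intro finite_subset[OF sub] finite_UN_I) auto
  have cardB: "real (card (B i)) \<le> (4 * T / h) * (2 * T / s + 1) ^ (CARD('n) - 1)" for i
  proof -
    have "card (B i) = (\<Prod>l\<in>UNIV. card (if l = i then P (1/2) h else P 0 s))"
      unfolding B_def by (rule card_vec_box) (use P in auto)
    also have "\<dots> = card (P (1/2) h) * (\<Prod>l\<in>UNIV - {i}. card (if l = i then P (1/2) h else P 0 s))"
      by (subst prod.remove[of _ i]) auto
    also have "(\<Prod>l\<in>UNIV - {i}. card (if l = i then P (1/2) h else P 0 s)) = (\<Prod>l\<in>UNIV - {i}. card (P 0 s))"
      by (rule prod.cong) auto
    also have "\<dots> = card (P 0 s) ^ (CARD('n) - 1)"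
      by (simp add: card_Diff_singleton)
    finally have "real (card (B i)) = real (card (P (1/2) h)) * real (card (P 0 s)) ^ (CARD('n) - 1)"
      by simp
    also have "\<dots> \<le> (4 * T / h) * (2 * T / s + 1) ^ (CARD('n) - 1)"
    proof (intro mult_mono power_mono)
      \<comment> \<open>\<open>T \<ge> h / 2\<close> gives \<open>1 \<le> 2 * T / h\<close>, which
        absorbs the summand 1 of the count.\<close>
      show "real (card (P (1/2) h)) \<le> 4 * T / h"
        using P(2) assms by (simp add: field_simps)
    qed (use P T assms in auto)
    finally show ?thesis .
  qed
  have "card G \<le> card (\<Union>i\<in>UNIV. B i)"
    using sub finB by (intro card_mono) auto
  also have "\<dots> \<le> (\<Sum>i\<in>UNIV. card (B i))"
    by (rule card_UN_le) simp
  finally have "real (card G) \<le> (\<Sum>i\<in>UNIV. real (card (B i)))"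
    unfolding of_nat_sum[symmetric] of_nat_le_iff .
  also have "\<dots> \<le> (\<Sum>i\<in>(UNIV :: 'n set). (4 * T / h) * (2 * T / s + 1) ^ (CARD('n) - 1))"
    by (intro sum_mono cardB)
  finally show "real (card G) \<le> CARD('n) * (4 * T / h) * (2 * T / s + 1) ^ (CARD('n) - 1)"
    by (simp add: mult.assoc)
qed

section \<open>Visibility at a single scale\<close>

text \<open>Comparing the Euclidean norm with the l1 norm costs a factor \<open>CARD('n)\<close>
  twice: in finding a coordinate along which the segment has extent at least \<open>h\<close>, and
  in bounding the error of rounding a crossing point to the grid.\<close>

lemma slab_grid_near_segment:
  fixes a b :: "real ^ 'n::finite" and h s :: real
  assumes "h > 0" "s > 0" "dist a b \<ge> CARD('n) * h"
  shows "\<exists>x\<in>slab_grid h s. infdist x (closed_segment a b) \<le> CARD('n) * s"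
proof -
  have "\<exists>i. h \<le> \<bar>(b - a) $ i\<bar>"
  proof (rule ccontr)
    assume "\<nexists>i. h \<le> \<bar>(b - a) $ i\<bar>"
    then have "(\<Sum>i\<in>UNIV. \<bar>(b - a) $ i\<bar>) < (\<Sum>i\<in>(UNIV :: 'n set). h)"
      by (intro sum_strict_mono) (auto simp: not_le)
    then show False
      using norm_le_l1_cart[of "b - a"] assms(3) by (simp add: dist_norm norm_minus_commute)
  qed
  then obtain i where i: "h \<le> \<bar>b $ i - a $ i\<bar>" by auto
  define p where "p = min (a $ i) (b $ i)"
  \<comment> \<open>The least \<open>k\<close> whose offset \<open>(of_int k + 1/2) * h\<close> is
    at least \<open>p\<close>; that offset exceeds \<open>p\<close> by at most \<open>h\<close>, so
    it stays within the extent of the segment.\<close>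
  define k where "k = \<lceil>p / h - 1/2\<rceil>"
  define y where "y = (of_int k + 1/2) * h"
  have "p / h \<le> of_int k + 1/2" "of_int k + 1/2 \<le> p / h + 1"
    unfolding k_def by linarith+
  then have "p \<le> y" "y \<le> p + h"
    using \<open>h > 0\<close> unfolding y_def by (auto simp: field_simps)
  then have y: "p \<le> y" "y \<le> max (a $ i) (b $ i)"
    using i unfolding p_def by auto
  \<comment> \<open>Intermediate values on the connected segment; the cases orient the
    endpoints.\<close>
  have "\<exists>z\<in>closed_segment a b. z $ i = y"
  proof (cases "a $ i \<le> b $ i")
    case True
    then show ?thesis
      using y connected_ivt_component_cart[of "closed_segment a b" a b i y] by (auto simp: p_def)
  next
    case False
    then show ?thesis
      using y connected_ivt_component_cart[of "closed_segment a b" b a i y] by (auto simp: p_def)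
  qed
  then obtain z where z: "z \<in> closed_segment a b" "z $ i = y" by blast
  \<comment> \<open>Coordinate \<open>i\<close> of \<open>z\<close> already has the right value; the
    others are rounded down to multiples of \<open>s\<close>.\<close>
  define x :: "real ^ 'n" where "x = (\<chi> l. if l = i then y else of_int \<lfloor>z $ l / s\<rfloor> * s)"
  have "x \<in> slab_grid h s"
    unfolding slab_grid_def x_def y_def by auto
  moreover have "\<bar>(x - z) $ l\<bar> \<le> s" for l
  proof (cases "l = i")
    case True
    then show ?thesis using z \<open>s > 0\<close> by (simp add: x_def)
  next
    case False
    define m where "m = \<lfloor>z $ l / s\<rfloor>"
    have "of_int m \<le> z $ l / s" "z $ l / s \<le> of_int m + 1"
      unfolding m_def by linarith+
    then have "of_int m * s \<le> z $ l" "z $ l \<le> of_int m * s + s"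
      using \<open>s > 0\<close> by (auto simp: field_simps)
    moreover have "x $ l = of_int m * s"
      using False by (simp add: x_def m_def)
    ultimately show ?thesis by simp
  qed
  then have "(\<Sum>l\<in>UNIV. \<bar>(x - z) $ l\<bar>) \<le> (\<Sum>l\<in>(UNIV :: 'n set). s)"
    by (intro sum_mono)
  then have "dist x z \<le> CARD('n) * s"
    using norm_le_l1_cart[of "x - z"] by (simp add: dist_norm)
  then have "infdist x (closed_segment a b) \<le> CARD('n) * s"
    using infdist_le[OF z(1), of x] by linarith
  ultimately show ?thesis by blast
qed

section \<open>Finite density of the union over all scales\<close>

text \<open>Scale \<open>j\<close> contributes at most \<open>K * T ^ CARD('n) * w j\<close> points,
  with \<open>K\<close> independent of \<open>T\<close> and \<open>j\<close>. As \<open>h\<close>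
  tends to infinity, only finitely many scales meet a given ball, and the partial sums of
  \<open>w\<close> are bounded by \<open>suminf w\<close> uniformly in \<open>T\<close>.\<close>

lemma finite_density_UN_slab_grid:
  fixes h s :: "nat \<Rightarrow> real"
  assumes pos: "\<And>j. h j > 0" "\<And>j. s j > 0"
    and bounds: "c > 0" "\<And>j. c \<le> h j" "\<And>j. s j \<le> 1"
    and h_lim: "filterlim h at_top sequentially"
    and summ: "summable (\<lambda>j. 1 / (h j * s j ^ (CARD('n) - 1)))"
  shows "finite_density (\<Union>j. slab_grid (h j) (s j) :: (real ^ 'n::finite) set)"
proof -
  let ?d = "CARD('n)"
  define w where "w j = 1 / (h j * s j ^ (?d - 1))" for j
  define K where "K = real ?d * 4 * (2 + 2 / c) ^ (?d - 1)"
  have K: "K > 0" unfolding K_def using bounds(1) by (simp add: add_pos_pos)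
  have w: "w j > 0" for j unfolding w_def using pos by simp
  let ?G = "\<lambda>j. slab_grid (h j) (s j) :: (real ^ 'n) set"
  have one: "finite (cball 0 T \<inter> ?G j) \<and> real (card (cball 0 T \<inter> ?G j)) \<le> K * T ^ ?d * w j"
    if "T > 0" for T j
  proof (cases "T < h j / 2")
    case True
    then show ?thesis
      using slab_grid_cball_empty[OF True, of "s j", where 'n = 'n] that K less_imp_le[OF w] by simp
  next
    case False
    note c = card_slab_grid_le[OF pos[of j], of T, where 'n = 'n]
    \<comment> \<open>Here \<open>c \<le> h j \<le> 2 * T\<close> and \<open>s j \<le> 1\<close>, so
      the summand 1 is at most \<open>(2 / c) * (T / s j)\<close>. This is the origin of
      \<open>2 + 2 / c\<close> in \<open>K\<close>.\<close>
    have "1 \<le> 2 * T / c"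
      using False bounds(1) bounds(2)[of j] by (simp add: field_simps)
    also have "\<dots> \<le> (2 * T / c) / s j"
      using pos(2)[of j] bounds(1) bounds(3)[of j] that
      by (simp add: field_simps)
    finally have "2 * T / s j + 1 \<le> (2 + 2 / c) * (T / s j)"
      by (simp add: algebra_simps)
    then have "(2 * T / s j + 1) ^ (?d - 1) \<le> ((2 + 2 / c) * (T / s j)) ^ (?d - 1)"
      using that pos(2)[of j] by (intro power_mono) auto
    then have "?d * (4 * T / h j) * (2 * T / s j + 1) ^ (?d - 1)
        \<le> ?d * (4 * T / h j) * ((2 + 2 / c) * (T / s j)) ^ (?d - 1)"
      using that pos(1)[of j] by (intro mult_left_mono) auto
    also have "\<dots> = K * (T * T ^ (?d - 1)) * w j"
      unfolding K_def w_def by (simp add: power_mult_distrib power_divide)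
    also have "T * T ^ (?d - 1) = T ^ ?d"
      using power_eq_if[of T ?d] by simp
    finally show ?thesis
      using c False by simp
  qed
  show ?thesis
    unfolding finite_density_def
  proof (intro exI conjI allI impI)
    show "K * suminf w > 0"
      using K w summ suminf_pos[of w] unfolding w_def by simp
    fix T :: real assume T: "T > 0"
    have "eventually (\<lambda>j. h j > 2 * T) sequentially"
      using h_lim by (simp add: filterlim_at_top_dense)
    then obtain N where N: "\<And>j. j \<ge> N \<Longrightarrow> h j > 2 * T"
      unfolding eventually_sequentially by blast
    have "cball 0 T \<inter> ?G j = {}" if "j \<ge> N" for j
      using N[OF that] by (intro slab_grid_cball_empty) simp
    then have eq: "cball 0 T \<inter> (\<Union>j. ?G j) = (\<Union>j<N. cball 0 T \<inter> ?G j)"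
      by (force simp: not_less[symmetric])
    show "finite (cball 0 T \<inter> (\<Union>j. ?G j))"
      unfolding eq using one[OF T] by blast
    have "real (card (cball 0 T \<inter> (\<Union>j. ?G j))) \<le> (\<Sum>j<N. real (card (cball 0 T \<inter> ?G j)))"
      unfolding eq of_nat_sum[symmetric] of_nat_le_iff by (rule card_UN_le) simp
    also have "\<dots> \<le> (\<Sum>j<N. K * T ^ ?d * w j)"
      using one[OF T] by (intro sum_mono) blast
    also have "\<dots> = K * T ^ ?d * (\<Sum>j<N. w j)"
      by (simp add: sum_distrib_left)
    also have "\<dots> \<le> K * T ^ ?d * suminf w"
      using summ w K T unfolding w_def[symmetric]
      by (intro mult_left_mono sum_le_suminf) (auto intro: less_imp_le)
    finally show "real (card (cball 0 T \<inter> (\<Union>j. ?G j))) \<le> K * suminf w * T ^ ?d"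
      by (simp add: mult_ac)
  qed
qed

section \<open>The step function as a visibility function\<close>

text \<open>Since the selected term is at most \<epsilon>, the new function dominates
  \<open>V\<close> on the unit interval and inherits its divergence. It is decreasing because the
  selected term is a non-decreasing function of \<epsilon>.\<close>

lemma blowup_function_scale_index:
  fixes V :: "real \<Rightarrow> real" and e :: "nat \<Rightarrow> real"
  assumes V: "blowup_function V"
    and e: "\<And>j. j \<ge> 1 \<Longrightarrow> e j \<in> {0<..<1}" and anti: "antimono_on {1..} e" and lim: "e \<longlonglongrightarrow> 0"
  shows "blowup_function (\<lambda>\<epsilon>. V (e (scale_index e \<epsilon>)))"
proof -
  let ?i = "scale_index e"
  have idx: "?i \<epsilon> \<ge> 1" "e (?i \<epsilon>) \<le> \<epsilon>" "\<epsilon> < (e(0 := 1)) (?i \<epsilon> - 1)" if "\<epsilon> \<in> {0<..<1}" for \<epsilon>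
    using theI'[OF scale_index_ex1[OF anti lim that]] unfolding scale_index_def by auto
  have V_pos: "V \<epsilon> > 0" if "\<epsilon> \<in> {0<..<1}" for \<epsilon>
    using V that unfolding blowup_function_def by blast
  have V_le: "V y \<le> V x" if "x \<in> {0<..<1}" "y \<in> {0<..<1}" "x \<le> y" for x y
    using V that unfolding blowup_function_def by (blast dest: monotone_onD)
  have e_mono: "e (?i x) \<le> e (?i y)" if xy: "x \<in> {0<..<1}" "y \<in> {0<..<1}" "x \<le> y" for x y
  proof (rule monotone_onD[OF anti])
    show "?i y \<le> ?i x"
    proof (rule ccontr)
      assume "\<not> ?i y \<le> ?i x"
      \<comment> \<open>Here \<open>?i y - 1\<close> is at least 1, so the convention at index 0
        does not intervene, and
        \<open>e (?i y - 1) \<le> e (?i x) \<le> x \<le> y < e (?i y - 1)\<close> is absurd.\<close>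
      then have le: "1 \<le> ?i x" "?i x \<le> ?i y - 1"
        using idx(1)[OF xy(1)] by auto
      then have "e (?i y - 1) \<le> e (?i x)"
        using monotone_onD[OF anti, of "?i x" "?i y - 1"] by auto
      then show False
        using idx(2)[OF xy(1)] idx(3)[OF xy(2)] xy(3) le by (auto split: if_splits)
    qed
  qed (use idx(1) xy in auto)
  have "filterlim (\<lambda>\<epsilon>. V (e (?i \<epsilon>))) at_top (at_right 0)"
  proof (rule filterlim_at_top_mono)
    show "filterlim V at_top (at_right 0)"
      using V unfolding blowup_function_def by blast
    have "eventually (\<lambda>\<epsilon>::real. \<epsilon> \<in> {0<..<1}) (at_right 0)"
      by (rule eventually_at_right_real) simp
    then show "eventually (\<lambda>\<epsilon>. V \<epsilon> \<le> V (e (?i \<epsilon>))) (at_right 0)"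
      by (rule eventually_mono) (intro V_le idx e)
  qed
  moreover have "antimono_on {0<..<1} (\<lambda>\<epsilon>. V (e (?i \<epsilon>)))"
    by (intro monotone_onI V_le e_mono e idx(1))
  ultimately show ?thesis
    using V_pos idx(1) e unfolding blowup_function_def by blast
qed

section \<open>Choice of the scales and conclusion\<close>

theorem theorem1p0p1:
  fixes V :: "real \<Rightarrow> real" and e :: "nat \<Rightarrow> real"
  assumes "CARD('n::finite) \<ge> 2"
    and "\<forall>\<epsilon>\<in>{0<..<1}. V \<epsilon> > 0"
    and "antimono_on {0<..<1} V"
    and "filterlim V at_top (at_right 0)"
    and "\<forall>j\<ge>1. e j \<in> {0<..<1}"
    and "antimono_on {1..} e"
    and "e \<longlonglongrightarrow> 0"
    and "summable (\<lambda>j. e (Suc j) powi (- (int CARD('n) - 1)) / V (e (Suc j)))"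
  shows "\<exists>F :: (real ^ 'n) set. dense_forest F (\<lambda>\<epsilon>. V (e (scale_index e \<epsilon>)))"
proof -
  let ?d = "real CARD('n)"
  \<comment> \<open>Division by the dimension offsets the two factors \<open>CARD('n)\<close> in
    \<open>slab_grid_near_segment\<close>; \<open>Suc\<close> makes the scales start at index
    1.\<close>
  define h where "h j = V (e (Suc j)) / ?d" for j
  define s where "s j = e (Suc j) / ?d" for j
  define F :: "(real ^ 'n) set" where "F = (\<Union>j. slab_grid (h j) (s j))"
  have d: "?d \<ge> 1" by (simp add: Suc_leI)
  have e: "0 < e (Suc j)" "e (Suc j) < 1" for j
    using assms(5) by auto
  have hs: "h j > 0" "s j > 0" for j
    unfolding h_def s_def using assms(2) e[of j] by auto
  have "finite_density F"
    unfolding F_def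
  \<comment> \<open>The lower bound \<open>c\<close> is \<open>h 0\<close>, the smallest spacing,
    because \<open>e\<close> and \<open>V\<close> are both decreasing.\<close>
  proof (rule finite_density_UN_slab_grid[OF hs hs(1)[of 0]])
    fix j
    have "e (Suc j) \<le> e (Suc 0)"
      using monotone_onD[OF assms(6), of "Suc 0" "Suc j"] by simp
    then have "V (e (Suc 0)) \<le> V (e (Suc j))"
      using monotone_onD[OF assms(3), of "e (Suc j)" "e (Suc 0)"] e by simp
    then show "h 0 \<le> h j"
      unfolding h_def by (simp add: divide_right_mono)
    show "s j \<le> 1"
      unfolding s_def using order_trans[OF less_imp_le[OF e(2)[of j]] d] by simp
  next
    \<comment> \<open>Positivity of the terms turns convergence to 0 into convergence from the
      right, where the limit of \<open>V\<close> is known.\<close>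
    have "filterlim (\<lambda>j. e (Suc j)) (at_right 0) sequentially"
      using LIMSEQ_Suc[OF assms(7)] e by (auto simp: filterlim_at less_imp_neq[OF e(1), symmetric])
    then have "filterlim (\<lambda>j. V (e (Suc j))) at_top sequentially"
      using filterlim_compose[OF assms(4)] by blast
    then have "filterlim (\<lambda>j. V (e (Suc j)) * inverse ?d) at_top sequentially"
      by (rule filterlim_at_top_mult_tendsto_pos[OF tendsto_const, rotated]) simp
    then show "filterlim h at_top sequentially"
      unfolding h_def by (simp add: divide_inverse)
  next
    have d_eq: "int CARD('n) - 1 = int (CARD('n) - 1)"
      using d by (simp add: of_nat_diff)
    \<comment> \<open>Rescaling by the dimension changes each term of the given series only by a
      constant factor.\<close>
    have "1 / (h j * s j ^ (CARD('n) - 1))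
        = ?d * ?d ^ (CARD('n) - 1) * (e (Suc j) powi (- (int CARD('n) - 1)) / V (e (Suc j)))" for j
      unfolding h_def s_def d_eq power_int_minus power_int_of_nat
      by (simp add: power_divide divide_simps)
    then show "summable (\<lambda>j. 1 / (h j * s j ^ (CARD('n) - 1)))"
      using summable_mult[OF assms(8)] by simp
  qed
  moreover have "blowup_function (\<lambda>\<epsilon>. V (e (scale_index e \<epsilon>)))"
    using assms(2-7) by (intro blowup_function_scale_index) (auto simp: blowup_function_def)
  moreover have "\<exists>x\<in>F. infdist x (closed_segment a b) \<le> \<epsilon>"
    if \<epsilon>: "\<epsilon> \<in> {0<..<1}" and ab: "dist a b = V (e (scale_index e \<epsilon>))" for \<epsilon> a b
  proof -
    have "scale_index e \<epsilon> \<ge> 1" "e (scale_index e \<epsilon>) \<le> \<epsilon>"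
      using theI'[OF scale_index_ex1[OF assms(6,7) \<epsilon>]] unfolding scale_index_def by auto
    \<comment> \<open>The single scale selected by \<open>scale_index\<close> suffices: the segment
      has exactly its visibility, and its precision is at most \<epsilon>.\<close>
    then obtain j where j: "scale_index e \<epsilon> = Suc j" "e (Suc j) \<le> \<epsilon>"
      by (cases "scale_index e \<epsilon>") auto
    then have "\<exists>x\<in>slab_grid (h j) (s j). infdist x (closed_segment a b) \<le> ?d * s j"
      using ab by (intro slab_grid_near_segment hs) (simp add: h_def)
    moreover have "?d * s j \<le> \<epsilon>"
      using j(2) by (simp add: s_def)
    ultimately show ?thesis
      unfolding F_def by (meson UN_I UNIV_I order_trans)
  qed
  ultimately show ?thesis
    unfolding dense_forest_def by blast
qed

end
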